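(* Let $m\ge 1$ be an integer and let $\mathbf t=\{t_0,t_1,\ldots,t_m\}$ be a set of real numbers that satisfies $$\cos\frac{\pi}{2m+1}<t_0<t_1<\cdots<t_m<1 .$$ For $1\le j\le m-1$ let $X_j(t)\in\mathbb R^{m+1}$ be the column vector with entries $$U_{2m}(t),U_{2m-2}(t),\ldots,U_{2j}(t),\;U_{2m-1}(t),U_{2m-3}(t),\ldots,U_{2m-2j+1}(t),$$ and let $\Xi_j(\mathbf t)=[X_j(t_0),X_j(t_1),\ldots,X_j(t_m)]$, an $(m+1)\times(m+1)$ matrix. Then the matrices $\Xi_1(\mathbf t),\ldots,\Xi_{m-1}(\mathbf t)$ are all nonsingular.
   Context: $U_k$ is the Chebyshev polynomial of the second kind, $U_k(\cos\theta)=\sin((k+1)\theta)/\sin\theta$. *)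

theory Defs
  imports
    Complex_Main
    "HOL-Computational_Algebra.Polynomial"
    "Jordan_Normal_Form.Matrix"
begin

text \<open>
  Chebyshev polynomials of the second kind. They are defined by the three-term recurrence;
  the lemmas \<open>cheb_U_cos\<close> and \<open>cheb_U_unique\<close> show that \<open>cheb_U n\<close> is the unique real polynomial
  with \<open>U\<^sub>n (cos \<theta>) = sin ((n+1) \<theta>) / sin \<theta>\<close> wherever the right-hand side makes sense.
\<close>

fun cheb_U :: "nat \<Rightarrow> real poly" where
  "cheb_U 0 = 1"
| "cheb_U (Suc 0) = [:0, 2:]"
| "cheb_U (Suc (Suc n)) = [:0, 2:] * cheb_U (Suc n) - cheb_U n"

lemma cheb_U_sin: "poly (cheb_U n) (cos \<theta>) * sin \<theta> = sin (real (n + 1) * \<theta>)"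
proof (induction n rule: cheb_U.induct)
  case 1
  show ?case by simp
next
  case 2
  show ?case using sin_double[of \<theta>] by simp
next
  case (3 n)
  let ?a = "real (Suc n + 1) * \<theta>"
  have up: "real (Suc (Suc n) + 1) * \<theta> = ?a + \<theta>"
    unfolding of_nat_add of_nat_Suc distrib_right by linarith
  have down: "real (n + 1) * \<theta> = ?a - \<theta>"
    unfolding of_nat_add of_nat_Suc distrib_right by linarith
  have "poly (cheb_U (Suc (Suc n))) (cos \<theta>)
          = 2 * cos \<theta> * poly (cheb_U (Suc n)) (cos \<theta>) - poly (cheb_U n) (cos \<theta>)"
    by simp
  then have "poly (cheb_U (Suc (Suc n))) (cos \<theta>) * sin \<theta>
          = 2 * cos \<theta> * (poly (cheb_U (Suc n)) (cos \<theta>) * sin \<theta>) - poly (cheb_U n) (cos \<theta>) * sin \<theta>"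
    by (simp only: left_diff_distrib mult.assoc)
  also have "\<dots> = 2 * cos \<theta> * sin ?a - sin (?a - \<theta>)"
    by (simp only: 3 down)
  also have "\<dots> = sin (?a + \<theta>)"
    unfolding sin_add sin_diff by (simp only: mult.commute mult.left_commute)
  finally show ?case unfolding up .
qed

lemma cheb_U_cos:
  assumes "sin \<theta> \<noteq> 0"
  shows "poly (cheb_U n) (cos \<theta>) = sin (real (n + 1) * \<theta>) / sin \<theta>"
  unfolding nonzero_eq_divide_eq[OF assms] by (rule cheb_U_sin)

lemma cheb_U_unique:
  assumes "\<And>\<theta>. sin \<theta> \<noteq> 0 \<Longrightarrow> poly p (cos \<theta>) = sin (real (n + 1) * \<theta>) / sin \<theta>"
  shows "p = cheb_U n"
proof -
  have "poly p x = poly (cheb_U n) x" if "-1 < x" "x < 1" for x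
  proof -
    have *: "cos (arccos x) = x"
      by (rule cos_arccos) (use that in linarith)+
    have "sin (arccos x) \<noteq> 0"
      using that by (rule sin_arccos_nonzero)
    from assms[OF this] cheb_U_cos[OF this, of n] show ?thesis
      unfolding * by (rule trans[OF _ sym])
  qed
  then have "{-1<..<1} \<subseteq> {x. poly (p - cheb_U n) x = 0}"
    by auto
  moreover have "infinite {-1<..<(1::real)}"
    by (rule infinite_Ioo) linarith
  ultimately have "infinite {x. poly (p - cheb_U n) x = 0}"
    by (rule infinite_super)
  then have "p - cheb_U n = 0"
    by (rule contrapos_np) (rule poly_roots_finite)
  then show ?thesis
    by (rule iffD1[OF right_minus_eq])
qed

text \<open>
  The even-index block is \<open>2m, 2m-2, \<dots>, 2j\<close> and the odd-index block is
  \<open>2m-1, 2m-3, \<dots>, 2m-2j+1\<close>. For \<open>j \<le> m\<close> no subtraction on \<^typ>\<open>nat\<close> truncates.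
\<close>

definition X_vec :: "nat \<Rightarrow> nat \<Rightarrow> real \<Rightarrow> real vec" where
  "X_vec m j s = vec_of_list
     (map (\<lambda>k. poly (cheb_U (2 * m - 2 * k)) s) [0..<m - j + 1] @
      map (\<lambda>k. poly (cheb_U (2 * m - 1 - 2 * k)) s) [0..<j])"

lemma X_vec_carrier:
  assumes "j \<le> m"
  shows "X_vec m j s \<in> carrier_vec (m + 1)"
proof (rule carrier_vecI)
  have "dim_vec (X_vec m j s) = (m - j + 1) + j"
    unfolding X_vec_def dim_vec_of_list by (simp only: length_append length_map length_upt diff_zero)
  also have "\<dots> = m + 1"
    using assms by linarith
  finally show "dim_vec (X_vec m j s) = m + 1" .
qed

definition Xi_mat :: "nat \<Rightarrow> nat \<Rightarrow> (nat \<Rightarrow> real) \<Rightarrow> real mat" where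
  "Xi_mat m j t = mat_of_cols (m + 1) (map (\<lambda>i. X_vec m j (t i)) [0..<m + 1])"

end

theory Submission
  imports Defs "Jordan_Normal_Form.Determinant"
begin

text \<open>
  With \<open>t = cos \<theta>\<close>, a vanishing linear combination of the rows of \<open>\<Xi>\<^sub>j\<close> is, up to the factor
  \<open>sin \<theta>\<close>, a sine sum with \<open>m + 1\<close> distinct frequencies in \<open>(0, 2m + 1]\<close> and \<open>m + 1\<close> zeros in
  \<open>(0, \<pi> / (2m + 1))\<close>. No nonzero sine sum \<open>f\<close> with \<open>n\<close> distinct frequencies in \<open>(0, N]\<close> has
  \<open>n\<close> zeros in \<open>(0, \<pi> / N)\<close>: for a frequency \<open>a\<close> of \<open>f\<close>, the function \<open>sin (a \<theta>)\<close> has no zeros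
  there, so by Rolle \<open>(f / sin (a \<theta>))'\<close> has \<open>n - 1\<close> zeros. The numerator
  \<open>h = f' sin (a \<theta>) - a f cos (a \<theta>)\<close> has these zeros and the additional zero \<open>0\<close>, so by Rolle
  \<open>h' = sin (a \<theta>) (f'' + a\<^sup>2 f)\<close> has \<open>n - 1\<close> zeros. But \<open>f'' + a\<^sup>2 f\<close> is a sine sum
  without the frequency \<open>a\<close>, and induction applies.
\<close>

text \<open>Each new maximum of \<open>Z\<close> yields, by the mean value theorem, a zero of
  \<open>g'\<close> above the old maximum, hence outside the \<open>Y\<close> found so far.
  Differentiability is assumed on the hull of \<open>Z\<close> only, so that quotients with poles
  elsewhere qualify; the strict bounds on \<open>Y\<close> keep the new zeros in the interval that
  contains \<open>Z\<close>.\<close>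

lemma Rolle_card:
  fixes g g' :: "real \<Rightarrow> real"
  assumes "finite Z" "Z \<noteq> {}"
    and "\<And>x. x \<in> Z \<Longrightarrow> g x = 0"
    and "\<And>x u v. u \<in> Z \<Longrightarrow> v \<in> Z \<Longrightarrow> u \<le> x \<Longrightarrow> x \<le> v \<Longrightarrow> (g has_real_derivative g' x) (at x)"
  shows "\<exists>Y. finite Y \<and> card Z = Suc (card Y) \<and>
    (\<forall>y\<in>Y. g' y = 0 \<and> (\<exists>u\<in>Z. u < y) \<and> (\<exists>v\<in>Z. y < v))"
  using assms
proof (induction Z rule: finite_linorder_max_induct)
  case empty
  then show ?case by simp
next
  case (insert x Z)
  show ?case
  proof (cases "Z = {}")
    case True
    then show ?thesis by (intro exI[of _ "{}"]) simp
  next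
    case False
    have "\<exists>Y. finite Y \<and> card Z = Suc (card Y) \<and>
      (\<forall>y\<in>Y. g' y = 0 \<and> (\<exists>u\<in>Z. u < y) \<and> (\<exists>v\<in>Z. y < v))"
      by (rule insert.IH[OF False]) (use insert.prems in blast)+
    then obtain Y where Y: "finite Y" "card Z = Suc (card Y)"
      "\<And>y. y \<in> Y \<Longrightarrow> g' y = 0 \<and> (\<exists>u\<in>Z. u < y) \<and> (\<exists>v\<in>Z. y < v)"
      by blast
    define p where "p = Max Z"
    have p: "p \<in> Z" "\<And>z. z \<in> Z \<Longrightarrow> z \<le> p"
      using insert.hyps False by (auto simp: p_def)
    have px: "p < x" using insert.hyps p by blast
    have der: "(g has_real_derivative g' y) (at y)" if "p \<le> y" "y \<le> x" for y
      using insert.prems(3)[of p x y] p that by blast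
    have "\<exists>y. p < y \<and> y < x \<and> g x - g p = (x - p) * g' y"
      using MVT2[OF px der] by blast
    then obtain y where y: "p < y" "y < x" "g x - g p = (x - p) * g' y"
      by blast
    have "g' y = 0" using y px insert.prems(2) p by auto
    have "y \<notin> Y" using Y(3)[of y] p(2) y(1) by force
    have "x \<notin> Z" using insert.hyps by blast
    show ?thesis
    proof (intro exI[of _ "insert y Y"] conjI ballI)
      show "card (insert x Z) = Suc (card (insert y Y))"
        using Y insert.hyps \<open>y \<notin> Y\<close> \<open>x \<notin> Z\<close> by simp
      fix w assume "w \<in> insert y Y"
      then show "g' w = 0" "\<exists>u\<in>insert x Z. u < w" "\<exists>v\<in>insert x Z. w < v"
        using Y(3) y p \<open>g' y = 0\<close> by auto
    qed (use Y in simp)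
  qed
qed

lemma sine_sum_coeffs_zero:
  fixes a c :: "'i \<Rightarrow> real"
  assumes "finite I" "inj_on a I"
    and "\<And>k. k \<in> I \<Longrightarrow> 0 < a k \<and> a k * T \<le> pi"
    and "finite Z" "card Z = card I" "Z \<subseteq> {0<..<T}"
    and "\<And>x. x \<in> Z \<Longrightarrow> (\<Sum>k\<in>I. c k * sin (a k * x)) = 0"
  shows "\<forall>k\<in>I. c k = 0"
  using assms
proof (induction I arbitrary: c Z rule: finite_induct)
  case empty
  then show ?case by simp
next
  case (insert i I)
  define b where "b = a i"
  define f where "f x = (\<Sum>k\<in>insert i I. c k * sin (a k * x))" for x
  define f' where "f' x = (\<Sum>k\<in>insert i I. c k * a k * cos (a k * x))" for x
  define f'' where "f'' x = (\<Sum>k\<in>insert i I. - (c k * (a k)\<^sup>2 * sin (a k * x)))" for x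
  define h where "h x = f' x * sin (b * x) - f x * (b * cos (b * x))" for x
  have f [derivative_intros]: "(f has_real_derivative f' x) (at x)" for x
    unfolding f_def f'_def by (auto intro!: derivative_eq_intros sum.cong)
  have f' [derivative_intros]: "(f' has_real_derivative f'' x) (at x)" for x
    unfolding f'_def f''_def
    by (auto intro!: derivative_eq_intros sum.cong simp: power2_eq_square)
  \<comment> \<open>The two terms \<open>b * f' x * cos (b * x)\<close> cancel.\<close>
  have h: "(h has_real_derivative sin (b * x) * (f'' x + b\<^sup>2 * f x)) (at x)" for x
    unfolding h_def
    by (auto intro!: derivative_eq_intros simp: algebra_simps power2_eq_square)
  have b: "0 < b" "b * T \<le> pi" using insert.prems(2) by (auto simp: b_def)
  have sin_pos: "0 < sin (b * x)" if "0 < x" "x < T" for x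
  proof (rule sin_gt_zero)
    show "0 < b * x" using b that by simp
    \<comment> \<open>Strict because \<open>x < T\<close>, even for a top frequency with
      \<open>b * T = pi\<close>.\<close>
    show "b * x < pi" using b(2) mult_strict_left_mono[OF that(2) b(1)] by linarith
  qed
  have "Z \<noteq> {}" using insert.prems(4) insert.hyps by auto
  have "\<exists>Y. finite Y \<and> card Z = Suc (card Y) \<and>
    (\<forall>y\<in>Y. h y / (sin (b * y) * sin (b * y)) = 0 \<and> (\<exists>u\<in>Z. u < y) \<and> (\<exists>v\<in>Z. y < v))"
  proof (rule Rolle_card[where g = "\<lambda>x. f x / sin (b * x)"])
    show "f x / sin (b * x) = 0" if "x \<in> Z" for x
      using insert.prems(6)[OF that] by (simp add: f_def)
    show "((\<lambda>x. f x / sin (b * x)) has_real_derivative h x / (sin (b * x) * sin (b * x))) (at x)"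
      if "u \<in> Z" "v \<in> Z" "u \<le> x" "x \<le> v" for x u v
    proof -
      have "sin (b * x) \<noteq> 0" using sin_pos[of x] insert.prems(5) that by force
      then show ?thesis unfolding h_def by (auto intro!: derivative_eq_intros simp: mult.commute)
    qed
  qed fact+
  then obtain Y where Y: "finite Y" "card Z = Suc (card Y)"
    "\<And>y. y \<in> Y \<Longrightarrow> h y / (sin (b * y) * sin (b * y)) = 0 \<and> (\<exists>u\<in>Z. u < y) \<and> (\<exists>v\<in>Z. y < v)"
    by blast
  have Y_T: "0 < y \<and> y < T" if "y \<in> Y" for y
    using Y(3)[OF that] insert.prems(5) by force
  \<comment> \<open>The zero of \<open>h\<close> at 0 makes up for the one lost in the first use of
    Rolle, so \<open>W\<close> has as many elements as \<open>I\<close>.\<close>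
  have "\<exists>W. finite W \<and> card (insert 0 Y) = Suc (card W) \<and>
    (\<forall>w\<in>W. sin (b * w) * (f'' w + b\<^sup>2 * f w) = 0 \<and> (\<exists>u\<in>insert 0 Y. u < w) \<and> (\<exists>v\<in>insert 0 Y. w < v))"
  proof (rule Rolle_card[where g = h])
    fix x assume "x \<in> insert 0 Y"
    then show "h x = 0"
      using Y(3)[of x] Y_T[of x] sin_pos[of x] by (auto simp: h_def f_def)
  qed (use Y h in auto)
  then obtain W where W: "finite W" "card (insert 0 Y) = Suc (card W)"
    "\<And>w. w \<in> W \<Longrightarrow> sin (b * w) * (f'' w + b\<^sup>2 * f w) = 0 \<and>
      (\<exists>u\<in>insert 0 Y. u < w) \<and> (\<exists>v\<in>insert 0 Y. w < v)"
    by blast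
  have W_T: "0 < w \<and> w < T" if "w \<in> W" for w
    using W(3)[OF that] Y_T by force
  have "0 \<notin> Y" using Y_T by blast
  \<comment> \<open>Same frequencies and \<open>T\<close>, but new coefficients and zeros: the term
    of \<open>i\<close> drops out because \<open>b = a i\<close>.\<close>
  have "\<forall>k\<in>I. (b\<^sup>2 - (a k)\<^sup>2) * c k = 0"
  proof (rule insert.IH[where Z = W])
    show "card W = card I"
      using W(2) Y insert.prems(4) insert.hyps \<open>0 \<notin> Y\<close> by simp
    show "W \<subseteq> {0<..<T}" using W_T by auto
    fix w assume w: "w \<in> W"
    have "f'' w + b\<^sup>2 * f w = (\<Sum>k\<in>insert i I. (b\<^sup>2 - (a k)\<^sup>2) * c k * sin (a k * w))"
      unfolding f_def f''_def sum_distrib_left sum.distrib[symmetric]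
      by (intro sum.cong) (auto simp: algebra_simps)
    also have "\<dots> = (\<Sum>k\<in>I. (b\<^sup>2 - (a k)\<^sup>2) * c k * sin (a k * w))"
      using insert.hyps by (simp add: b_def)
    finally show "(\<Sum>k\<in>I. (b\<^sup>2 - (a k)\<^sup>2) * c k * sin (a k * w)) = 0"
      using W(3)[OF w] sin_pos[of w] W_T[OF w] by simp
  qed (use insert.prems W in auto)
  \<comment> \<open>Positive frequencies exclude \<open>b = - a k\<close>.\<close>
  moreover have "b\<^sup>2 \<noteq> (a k)\<^sup>2" if "k \<in> I" for k
  proof -
    have "b \<noteq> a k" using insert.prems(1) insert.hyps that by (auto simp: b_def inj_on_def)
    then show ?thesis using b insert.prems(2)[of k] that by (simp add: power2_eq_iff)
  qed
  ultimately have c: "\<forall>k\<in>I. c k = 0" by auto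
  \<comment> \<open>Only the term of \<open>i\<close> is left in the sum, so a single zero settles
    \<open>c i\<close>.\<close>
  obtain z where z: "z \<in> Z" using \<open>Z \<noteq> {}\<close> by blast
  then have "c i * sin (b * z) = 0"
    using insert.prems(6)[OF z] insert.hyps c by (simp add: b_def)
  moreover have "0 < sin (b * z)" using sin_pos z insert.prems(5) by auto
  ultimately show ?case using c by simp
qed

lemma invertible_mat_if_det_nonzero:
  fixes A :: "'a :: field mat"
  assumes A: "A \<in> carrier_mat n n" and "det A \<noteq> 0"
  shows "invertible_mat A"
proof -
  from det_non_zero_imp_unit[OF assms, of "()"] obtain B
    where "B \<in> carrier_mat n n" "B * A = 1\<^sub>m n" "A * B = 1\<^sub>m n"
    by (auto simp: Units_def ring_mat_def)
  with A show ?thesis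
    by (auto simp: invertible_mat_def inverts_mat_def)
qed

lemma Xi_mat_index:
  assumes "j \<le> m" "r \<le> m" "i \<le> m"
  shows "Xi_mat m j t $$ (r, i) =
    poly (cheb_U (if r < m - j + 1 then 2 * m - 2 * r else 2 * m - 1 - 2 * (r - (m - j + 1)))) (t i)"
proof -
  have "Xi_mat m j t $$ (r, i) = X_vec m j (t i) $ r"
    using assms unfolding Xi_mat_def
    by (subst mat_of_cols_index) (auto simp del: upt_Suc)
  also have "\<dots> = poly (cheb_U (if r < m - j + 1 then 2 * m - 2 * r
      else 2 * m - 1 - 2 * (r - (m - j + 1)))) (t i)"
    using assms unfolding X_vec_def
    by (auto simp: vec_of_list_index nth_append simp del: upt_Suc)
  finally show ?thesis .
qed

theorem proposition2p10:
  fixes m :: nat and t :: "nat \<Rightarrow> real"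
  assumes "m \<ge> 1"
    and "cos (pi / (2 * real m + 1)) < t 0"
    and "\<And>i. i < m \<Longrightarrow> t i < t (Suc i)"
    and "t m < 1"
  shows "\<forall>j \<in> {1..m - 1}. invertible_mat (Xi_mat m j t)"
proof
  fix j assume j: "j \<in> {1..m - 1}"
  define T where "T = pi / (2 * real m + 1)"
  define A where "A = Xi_mat m j t"
  define d where
    "d r = (if r < m - j + 1 then 2 * m - 2 * r else 2 * m - 1 - 2 * (r - (m - j + 1)))" for r
  \<comment> \<open>The shift by 1 comes from \<open>cheb_U_sin\<close>; row 0 attains the largest
    frequency 2m + 1.\<close>
  define a where "a r = real (d r + 1)" for r
  have T_pos: "0 < T" and T_mult: "(2 * real m + 1) * T = pi"
    by (auto simp: T_def add_pos_nonneg)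
  have T: "x * T \<le> pi" if "x \<le> 2 * real m + 1" for x
    using mult_right_mono[OF that, of T] T_pos T_mult by linarith
  have A: "A \<in> carrier_mat (m + 1) (m + 1)" by (intro carrier_matI) (simp_all add: A_def Xi_mat_def)
  have t_mono: "t i < t k" if "i < k" "k \<le> m" for i k
    using that
  proof (induction k)
    case (Suc k)
    then show ?case using assms(3)[of k] by (cases "i = k") auto
  qed simp
  have t_bounds: "cos T < t i \<and> t i < 1" if "i \<le> m" for i
  proof
    have "t 0 \<le> t i" using t_mono[of 0 i] that by (cases "i = 0") auto
    then show "cos T < t i" using assms(2) by (simp add: T_def)
    have "t i \<le> t m" using t_mono[of i m] that by (cases "i = m") auto
    then show "t i < 1" using assms(4) by simp
  qed
  have t_range: "-1 < t i \<and> t i < 1" if "i \<le> m" for i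
    using t_bounds[OF that] cos_ge_minus_one[of T] by linarith
  define Z where "Z = (\<lambda>i. arccos (t i)) ` {..m}"
  have Z_T: "Z \<subseteq> {0<..<T}"
  proof
    fix z assume "z \<in> Z"
    then obtain i where i: "i \<le> m" "z = arccos (t i)" by (auto simp: Z_def)
    \<comment> \<open>Since arccos is decreasing, the lower bound on \<open>t i\<close> becomes the
      upper bound \<open>T\<close> on the angle; \<open>T[of 1]\<close> gives
      \<open>T \<le> pi\<close>, so \<open>arccos (cos T) = T\<close>.\<close>
    have "arccos (t i) < arccos (cos T)"
      using t_bounds[OF i(1)] by (intro arccos_less_arccos) auto
    moreover have "0 < arccos (t i)"
      using arccos_less_arccos[of "t i" 1] t_range[OF i(1)] by simp
    ultimately show "z \<in> {0<..<T}" using T_pos T[of 1] i by (simp add: arccos_cos)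
  qed
  have "inj_on (\<lambda>i. arccos (t i)) {..m}"
  proof (rule inj_onI)
    fix i k assume ik: "i \<in> {..m}" "k \<in> {..m}" and "arccos (t i) = arccos (t k)"
    then have "t i = t k"
      using t_range[of i] t_range[of k] by (subst (asm) arccos_eq_iff) auto
    then show "i = k"
      using t_mono[of i k] t_mono[of k i] ik by (cases i k rule: linorder_cases) auto
  qed
  then have card_Z: "card Z = card {..<m + 1}"
    by (simp add: Z_def card_image)
  have a_bounds: "0 < a r \<and> a r * T \<le> pi" if "r \<in> {..<m + 1}" for r
    using that T[of "a r"] j by (auto simp: a_def d_def)
  have inj: "inj_on a {..<m + 1}"
  proof (rule inj_onI)
    fix r s assume rs: "r \<in> {..<m + 1}" "s \<in> {..<m + 1}" and "a r = a s"
    then have eq: "d r = d s" by (simp add: a_def)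
    \<comment> \<open>In this form the parity of \<open>d x\<close> tells the block of row
      \<open>x\<close>, and within each block \<open>d\<close> is injective.\<close>
    have d: "d x = (if x < m - j + 1 then 2 * (m - x) else 2 * (2 * m - j - x) + 1)"
      if "x \<le> m" for x
      using that j by (auto simp: d_def)
    have "even (d x) \<longleftrightarrow> x < m - j + 1" if "x \<le> m" for x
      using d[OF that] by simp
    then have "r < m - j + 1 \<longleftrightarrow> s < m - j + 1"
      using eq rs by (metis lessThan_iff less_Suc_eq_le Suc_eq_plus1)
    then show "r = s"
      using eq d[of r] d[of s] rs j by (cases "r < m - j + 1") auto
  qed
  have "det A \<noteq> 0"
  proof
    assume "det A = 0"
    \<comment> \<open>A kernel vector of the transpose is a linear relation among the rows, that is,
      among the functions \<open>cheb_U (d r)\<close> on the nodes.\<close>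
    then have "det (transpose_mat A) = 0" using det_transpose[OF A] by simp
    then obtain v where v: "v \<in> carrier_vec (m + 1)" "v \<noteq> 0\<^sub>v (m + 1)"
      "transpose_mat A *\<^sub>v v = 0\<^sub>v (m + 1)"
      using det_0_iff_vec_prod_zero[of "transpose_mat A" "m + 1"] A by auto
    have "\<forall>r\<in>{..<m + 1}. v $ r = 0"
    proof (rule sine_sum_coeffs_zero[OF _ inj a_bounds _ card_Z Z_T])
      fix z assume "z \<in> Z"
      then obtain i where i: "i \<le> m" "z = arccos (t i)" by (auto simp: Z_def)
      have cos_z: "cos z = t i" using t_range[OF i(1)] i(2) by simp
      have "0 = (transpose_mat A *\<^sub>v v) $ i" using v i by simp
      also have "\<dots> = (\<Sum>r<m + 1. A $$ (r, i) * v $ r)"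
        using A v(1) i by (auto simp: scalar_prod_def atLeast0LessThan intro!: sum.cong)
      also have "\<dots> = (\<Sum>r<m + 1. poly (cheb_U (d r)) (cos z) * v $ r)"
        unfolding cos_z using i(1) j by (intro sum.cong) (auto simp: A_def Xi_mat_index d_def)
      \<comment> \<open>The factor \<open>sin z\<close> turns each Chebyshev value into a sine of
        frequency \<open>a r\<close>.\<close>
      finally have "0 = (\<Sum>r<m + 1. poly (cheb_U (d r)) (cos z) * v $ r) * sin z" by simp
      also have "\<dots> = (\<Sum>r<m + 1. v $ r * (poly (cheb_U (d r)) (cos z) * sin z))"
        unfolding sum_distrib_right by (simp only: ac_simps)
      also have "\<dots> = (\<Sum>r<m + 1. v $ r * sin (a r * z))"
        by (simp only: cheb_U_sin a_def)
      finally show "(\<Sum>r<m + 1. v $ r * sin (a r * z)) = 0" by simp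
    qed (auto simp: Z_def)
    then have "v = 0\<^sub>v (m + 1)" using v(1) by (intro eq_vecI) auto
    with v(2) show False by contradiction
  qed
  then show "invertible_mat (Xi_mat m j t)"
    using invertible_mat_if_det_nonzero[OF A] by (simp add: A_def)
qed

end
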